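(* An algebra $(S;\cdot,\backslash,/)$ with three binary operations is a right product quasigroup if and only if it satisfies the following five identities: (A1) $x\backslash(x\cdot y)=y$; (A2) $x\cdot(x\backslash y)=y$; (A3) $(x/y)\cdot y=(x\cdot y)/y$; (A4) $((x/y)\cdot y)/z=x/z$; (A5) $((x\cdot y)/z)\cdot z=x\cdot((y/z)\cdot z)$.
   Context: A quasigroup is an algebra $(Q;\cdot,\backslash,/)$ with three binary operations satisfying $x\backslash(x\cdot y)=y$, $x\cdot(x\backslash y)=y$, $(x\cdot y)/y=x$, $(x/y)\cdot y=x$. A right zero semigroup is regarded as an algebra $(R;\cdot,\backslash,/)$ with $x\cdot y=x\backslash y=x/y=y$ for all $x,y$. An algebra $(S;\cdot,\backslash,/)$ is a right product quasigroup if it is isomorphic to a direct product $Q\times R$ (componentwise operations) with $Q$ a quasigroup and $R$ a right zero semigroup. *)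

theory Defs
  imports "HOL-Algebra.Congruence"
begin

text \<open>
  Algebras with three binary operations, living on a carrier set. The operation
  \<open>x \<setminus> y\<close> is the left division, \<open>x \<oslash> y\<close> the right division
  \<open>x / y\<close>. Empty algebras are admitted throughout; as a product of two algebras is nonempty
  iff both factors are, this covers the convention that algebras are nonempty as well.
\<close>

record 'a ternary_algebra = "'a partial_object" +
  amult :: "'a \<Rightarrow> 'a \<Rightarrow> 'a" (infixl \<open>\<cdot>\<index>\<close> 70)
  ldiv :: "'a \<Rightarrow> 'a \<Rightarrow> 'a" (infixl \<open>\<setminus>\<index>\<close> 70)
  rdiv :: "'a \<Rightarrow> 'a \<Rightarrow> 'a" (infixl \<open>\<oslash>\<index>\<close> 70)

locale div_algebra =
  fixes S (structure)
  assumes amult_closed: "\<lbrakk>x \<in> carrier S; y \<in> carrier S\<rbrakk> \<Longrightarrow> x \<cdot> y \<in> carrier S"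
    and ldiv_closed: "\<lbrakk>x \<in> carrier S; y \<in> carrier S\<rbrakk> \<Longrightarrow> x \<setminus> y \<in> carrier S"
    and rdiv_closed: "\<lbrakk>x \<in> carrier S; y \<in> carrier S\<rbrakk> \<Longrightarrow> x \<oslash> y \<in> carrier S"

locale quasigroup = div_algebra Q for Q (structure) +
  assumes ldiv_amult: "\<lbrakk>x \<in> carrier Q; y \<in> carrier Q\<rbrakk> \<Longrightarrow> x \<setminus> (x \<cdot> y) = y"
    and amult_ldiv: "\<lbrakk>x \<in> carrier Q; y \<in> carrier Q\<rbrakk> \<Longrightarrow> x \<cdot> (x \<setminus> y) = y"
    and amult_rdiv: "\<lbrakk>x \<in> carrier Q; y \<in> carrier Q\<rbrakk> \<Longrightarrow> (x \<cdot> y) \<oslash> y = x"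
    and rdiv_amult: "\<lbrakk>x \<in> carrier Q; y \<in> carrier Q\<rbrakk> \<Longrightarrow> (x \<oslash> y) \<cdot> y = x"

text \<open>Associativity of the multiplication follows from \<open>x \<cdot> y = y\<close>.\<close>

locale right_zero_semigroup = div_algebra R for R (structure) +
  assumes amult_right: "\<lbrakk>x \<in> carrier R; y \<in> carrier R\<rbrakk> \<Longrightarrow> x \<cdot> y = y"
    and ldiv_right: "\<lbrakk>x \<in> carrier R; y \<in> carrier R\<rbrakk> \<Longrightarrow> x \<setminus> y = y"
    and rdiv_right: "\<lbrakk>x \<in> carrier R; y \<in> carrier R\<rbrakk> \<Longrightarrow> x \<oslash> y = y"

definition direct_prod ::
    "('a, 'm) ternary_algebra_scheme \<Rightarrow> ('b, 'n) ternary_algebra_scheme \<Rightarrow> ('a \<times> 'b) ternary_algebra"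
  where "direct_prod A B = \<lparr>carrier = carrier A \<times> carrier B,
    amult = (\<lambda>(a, b) (c, d). (a \<cdot>\<^bsub>A\<^esub> c, b \<cdot>\<^bsub>B\<^esub> d)),
    ldiv = (\<lambda>(a, b) (c, d). (a \<setminus>\<^bsub>A\<^esub> c, b \<setminus>\<^bsub>B\<^esub> d)),
    rdiv = (\<lambda>(a, b) (c, d). (a \<oslash>\<^bsub>A\<^esub> c, b \<oslash>\<^bsub>B\<^esub> d))\<rparr>"

definition alg_iso ::
    "('a, 'm) ternary_algebra_scheme \<Rightarrow> ('b, 'n) ternary_algebra_scheme \<Rightarrow> ('a \<Rightarrow> 'b) set"
  where "alg_iso A B = {f. bij_betw f (carrier A) (carrier B) \<and>
    (\<forall>x \<in> carrier A. \<forall>y \<in> carrier A.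
      f (x \<cdot>\<^bsub>A\<^esub> y) = f x \<cdot>\<^bsub>B\<^esub> f y \<and>
      f (x \<setminus>\<^bsub>A\<^esub> y) = f x \<setminus>\<^bsub>B\<^esub> f y \<and>
      f (x \<oslash>\<^bsub>A\<^esub> y) = f x \<oslash>\<^bsub>B\<^esub> f y)}"

text \<open>
  HOL cannot quantify existentially over types, so both factors are taken on the element type of
  the given algebra. The lemma \<open>right_product_quasigroupI\<close> below shows that this
  loses nothing: factors over arbitrary types are allowed.
\<close>

definition right_product_quasigroup :: "'a ternary_algebra \<Rightarrow> bool"
  where "right_product_quasigroup S \<longleftrightarrow>
    (\<exists>(Q :: 'a ternary_algebra) (R :: 'a ternary_algebra).
      quasigroup Q \<and> right_zero_semigroup R \<and> alg_iso S (direct_prod Q R) \<noteq> {})"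

definition transport :: "('b \<Rightarrow> 'a) \<Rightarrow> ('b, 'm) ternary_algebra_scheme \<Rightarrow> 'a ternary_algebra"
  where "transport e A = (let i = inv_into (carrier A) e in
    \<lparr>carrier = e ` carrier A,
     amult = (\<lambda>x y. e (i x \<cdot>\<^bsub>A\<^esub> i y)),
     ldiv = (\<lambda>x y. e (i x \<setminus>\<^bsub>A\<^esub> i y)),
     rdiv = (\<lambda>x y. e (i x \<oslash>\<^bsub>A\<^esub> i y))\<rparr>)"

lemma transport_simps:
  assumes "inj_on e (carrier A)"
  shows "carrier (transport e A) = e ` carrier A"
    and "\<lbrakk>x \<in> carrier A; y \<in> carrier A\<rbrakk> \<Longrightarrow> e x \<cdot>\<^bsub>transport e A\<^esub> e y = e (x \<cdot>\<^bsub>A\<^esub> y)"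
    and "\<lbrakk>x \<in> carrier A; y \<in> carrier A\<rbrakk> \<Longrightarrow> e x \<setminus>\<^bsub>transport e A\<^esub> e y = e (x \<setminus>\<^bsub>A\<^esub> y)"
    and "\<lbrakk>x \<in> carrier A; y \<in> carrier A\<rbrakk> \<Longrightarrow> e x \<oslash>\<^bsub>transport e A\<^esub> e y = e (x \<oslash>\<^bsub>A\<^esub> y)"
  using assms by (simp_all add: transport_def Let_def)

lemma quasigroup_transport:
  assumes "inj_on e (carrier Q)" "quasigroup Q"
  shows "quasigroup (transport e Q)"
proof -
  interpret quasigroup Q by fact
  note closed = amult_closed ldiv_closed rdiv_closed
  show ?thesis
    by unfold_locales
      (auto simp: transport_simps[OF assms(1)] closed ldiv_amult amult_ldiv amult_rdiv rdiv_amult)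
qed

lemma right_zero_semigroup_transport:
  assumes "inj_on e (carrier R)" "right_zero_semigroup R"
  shows "right_zero_semigroup (transport e R)"
proof -
  interpret right_zero_semigroup R by fact
  show ?thesis
    by unfold_locales
      (auto simp: transport_simps[OF assms(1)] amult_right ldiv_right rdiv_right)
qed

lemma right_product_quasigroupI:
  fixes S :: "'a ternary_algebra"
    and Q :: "('q, 'm) ternary_algebra_scheme" and R :: "('r, 'n) ternary_algebra_scheme"
  assumes Q: "quasigroup Q" and R: "right_zero_semigroup R"
    and f: "f \<in> alg_iso S (direct_prod Q R)"
  shows "right_product_quasigroup S"
proof (cases "carrier S = {}")
  case True
  then have "quasigroup S" "right_zero_semigroup S" "(\<lambda>x. (x, x)) \<in> alg_iso S (direct_prod S S)"
    by (auto simp: quasigroup_def quasigroup_axioms_def right_zero_semigroup_def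
        right_zero_semigroup_axioms_def div_algebra_def alg_iso_def direct_prod_def bij_betw_def)
  then show ?thesis unfolding right_product_quasigroup_def by blast
next
  case False
  have bij: "bij_betw f (carrier S) (carrier Q \<times> carrier R)"
    using f by (simp add: alg_iso_def direct_prod_def)
  obtain q0 r0 where 0: "q0 \<in> carrier Q" "r0 \<in> carrier R"
    using False bij by (metis bij_betw_def image_is_empty ex_in_conv mem_Sigma_iff surj_pair)
  define g where "g = inv_into (carrier S) f"
  have g: "inj_on g (carrier Q \<times> carrier R)"
    using bij bij_betw_inv_into[OF bij] by (simp add: g_def bij_betw_def)
  define eq where "eq = (\<lambda>q. g (q, r0))"
  define er where "er = (\<lambda>r. g (q0, r))"
  have eq: "inj_on eq (carrier Q)" and er: "inj_on er (carrier R)"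
    using g 0 by (auto simp: eq_def er_def inj_on_def)
  define h where "h = map_prod eq er \<circ> f"
  have b: "bij_betw (map_prod eq er) (carrier Q \<times> carrier R)
      (carrier (direct_prod (transport eq Q) (transport er R)))"
    using eq er
    by (auto simp: bij_betw_def direct_prod_def transport_simps map_prod_inj_on
        intro!: map_prod_surj_on)
  have "h \<in> alg_iso S (direct_prod (transport eq Q) (transport er R))"
    unfolding alg_iso_def
  proof (intro CollectI conjI ballI)
    show "bij_betw h (carrier S) (carrier (direct_prod (transport eq Q) (transport er R)))"
      unfolding h_def by (rule bij_betw_trans[OF bij b])
  next
    fix x y assume xy: "x \<in> carrier S" "y \<in> carrier S"
    obtain a b c d where fxy: "f x = (a, b)" "f y = (c, d)" by fastforce
    have mem: "a \<in> carrier Q" "c \<in> carrier Q" "b \<in> carrier R" "d \<in> carrier R"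
      using bij_betwE[OF bij] xy fxy by (metis mem_Sigma_iff)+
    have "f (x \<cdot>\<^bsub>S\<^esub> y) = (a \<cdot>\<^bsub>Q\<^esub> c, b \<cdot>\<^bsub>R\<^esub> d)"
      and "f (x \<setminus>\<^bsub>S\<^esub> y) = (a \<setminus>\<^bsub>Q\<^esub> c, b \<setminus>\<^bsub>R\<^esub> d)"
      and "f (x \<oslash>\<^bsub>S\<^esub> y) = (a \<oslash>\<^bsub>Q\<^esub> c, b \<oslash>\<^bsub>R\<^esub> d)"
      using f xy fxy by (auto simp: alg_iso_def direct_prod_def)
    then show "h (x \<cdot>\<^bsub>S\<^esub> y) = h x \<cdot>\<^bsub>direct_prod (transport eq Q) (transport er R)\<^esub> h y"
      and "h (x \<setminus>\<^bsub>S\<^esub> y) = h x \<setminus>\<^bsub>direct_prod (transport eq Q) (transport er R)\<^esub> h y"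
      and "h (x \<oslash>\<^bsub>S\<^esub> y) = h x \<oslash>\<^bsub>direct_prod (transport eq Q) (transport er R)\<^esub> h y"
      using fxy mem
      by (simp_all add: h_def direct_prod_def transport_simps[OF eq] transport_simps[OF er])
  qed
  then show ?thesis
    using quasigroup_transport[OF eq Q] right_zero_semigroup_transport[OF er R]
    unfolding right_product_quasigroup_def by blast
qed

end

theory Submission
  imports Defs
begin

text \<open>
  Everything rests on the derived operation \<open>x \<star> y = (x \<oslash> y) \<cdot> y\<close>. In a product of
  a quasigroup \<open>Q\<close> and a right zero semigroup \<open>R\<close> it sends \<open>(q, r)\<close> and
  \<open>(q', r')\<close> to \<open>(q, r')\<close>, that is, it takes the \<open>Q\<close>-coordinate of its first
  argument and the \<open>R\<close>-coordinate of its second. This makes the five identities evident in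
  the product, and an isomorphism carries them over.

  Conversely, \<open>((x \<oslash> y) \<cdot> y) \<oslash> z = x \<oslash> z\<close> gives
  \<open>(x \<star> y) \<star> z = x \<star> z\<close>, and the last identity reads
  \<open>(x \<cdot> y) \<star> z = x \<cdot> (y \<star> z)\<close>: left multiplications, hence also left divisions,
  commute with the maps \<open>y \<mapsto> y \<star> z\<close>. From this one derives \<open>x \<star> x = x\<close> and
  \<open>x \<star> (y \<star> z) = x \<star> z\<close>, so that \<open>\<star>\<close> is a rectangular band operation. For a
  fixed \<open>e\<close> a rectangular band is in bijection with a product through
  \<open>x \<mapsto> (x \<star> e, e \<star> x)\<close>, with inverse \<open>(a, b) \<mapsto> a \<star> b\<close>.

  It remains to see how the operations of \<open>S\<close> act on the two coordinates. The identity
  \<open>(x \<cdot> y) \<oslash> y = x \<star> y\<close> shows that \<open>x \<cdot> z\<close> does not change when \<open>x\<close> is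
  replaced by \<open>x \<star> y\<close>, and this makes \<open>x \<mapsto> x \<star> e\<close> an endomorphism of
  \<open>S\<close> (lemmas \<open>band_amult\<close>, \<open>band_ldiv\<close>, \<open>band_rdiv\<close>). Its image is a
  quasigroup because \<open>a \<star> b = a\<close> there. In the other coordinate, \<open>e \<star> x\<close>
  depends only on the right argument when \<open>x\<close> is a product or a quotient
  (lemma \<open>band_absorb\<close>).
\<close>

section \<open>The identities in a direct product\<close>

lemma direct_prod_simps:
  "carrier (direct_prod A B) = carrier A \<times> carrier B"
  "(a, b) \<cdot>\<^bsub>direct_prod A B\<^esub> (c, d) = (a \<cdot>\<^bsub>A\<^esub> c, b \<cdot>\<^bsub>B\<^esub> d)"
  "(a, b) \<setminus>\<^bsub>direct_prod A B\<^esub> (c, d) = (a \<setminus>\<^bsub>A\<^esub> c, b \<setminus>\<^bsub>B\<^esub> d)"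
  "(a, b) \<oslash>\<^bsub>direct_prod A B\<^esub> (c, d) = (a \<oslash>\<^bsub>A\<^esub> c, b \<oslash>\<^bsub>B\<^esub> d)"
  by (simp_all add: direct_prod_def)

locale right_product_identities = div_algebra S for S (structure) +
  assumes ldiv_amult: "\<lbrakk>x \<in> carrier S; y \<in> carrier S\<rbrakk> \<Longrightarrow> x \<setminus> (x \<cdot> y) = y"
    and amult_ldiv: "\<lbrakk>x \<in> carrier S; y \<in> carrier S\<rbrakk> \<Longrightarrow> x \<cdot> (x \<setminus> y) = y"
    and rdiv_amult_swap: "\<lbrakk>x \<in> carrier S; y \<in> carrier S\<rbrakk> \<Longrightarrow> (x \<oslash> y) \<cdot> y = (x \<cdot> y) \<oslash> y"
    and rdiv_amult_rdiv:
      "\<lbrakk>x \<in> carrier S; y \<in> carrier S; z \<in> carrier S\<rbrakk> \<Longrightarrow> ((x \<oslash> y) \<cdot> y) \<oslash> z = x \<oslash> z"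
    and amult_rdiv_amult:
      "\<lbrakk>x \<in> carrier S; y \<in> carrier S; z \<in> carrier S\<rbrakk> \<Longrightarrow>
        ((x \<cdot> y) \<oslash> z) \<cdot> z = x \<cdot> ((y \<oslash> z) \<cdot> z)"

lemma right_product_identities_direct_prod:
  assumes "quasigroup Q" "right_zero_semigroup R"
  shows "right_product_identities (direct_prod Q R)"
proof -
  interpret Q: quasigroup Q by fact
  interpret R: right_zero_semigroup R by fact
  note closed = Q.amult_closed Q.ldiv_closed Q.rdiv_closed
  note laws = Q.ldiv_amult Q.amult_ldiv Q.amult_rdiv Q.rdiv_amult
    R.amult_right R.ldiv_right R.rdiv_right
  show ?thesis
    by unfold_locales (auto simp: direct_prod_simps closed laws)
qed

lemma right_product_identities_alg_iso:
  assumes "div_algebra A" and f: "f \<in> alg_iso A B" and "right_product_identities B"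
  shows "right_product_identities A"
proof -
  interpret A: div_algebra A by fact
  interpret B: right_product_identities B by fact
  have inj: "inj_on f (carrier A)" and mem: "\<And>x. x \<in> carrier A \<Longrightarrow> f x \<in> carrier B"
    using f by (auto simp: alg_iso_def bij_betw_def)
  have hom: "f (x \<cdot>\<^bsub>A\<^esub> y) = f x \<cdot>\<^bsub>B\<^esub> f y" "f (x \<setminus>\<^bsub>A\<^esub> y) = f x \<setminus>\<^bsub>B\<^esub> f y" "f (x \<oslash>\<^bsub>A\<^esub> y) = f x \<oslash>\<^bsub>B\<^esub> f y"
    if "x \<in> carrier A" "y \<in> carrier A" for x y
    using f that by (auto simp: alg_iso_def)
  note closed = A.amult_closed A.ldiv_closed A.rdiv_closed
  show ?thesis
    by unfold_locales
      (rule inj_onD[OF inj];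
        simp add: hom closed mem B.ldiv_amult B.amult_ldiv B.rdiv_amult_swap[symmetric] B.rdiv_amult_rdiv
          B.amult_rdiv_amult)+
qed

section \<open>The rectangular band\<close>

context right_product_identities
begin

definition band :: "'a \<Rightarrow> 'a \<Rightarrow> 'a" (infixl \<open>\<star>\<close> 70)
  where "x \<star> y = (x \<oslash> y) \<cdot> y"

lemma band_closed: "\<lbrakk>x \<in> carrier S; y \<in> carrier S\<rbrakk> \<Longrightarrow> x \<star> y \<in> carrier S"
  by (simp add: band_def amult_closed rdiv_closed)

lemmas closed = amult_closed ldiv_closed rdiv_closed band_closed

lemma amult_rdiv_eq_band: "\<lbrakk>x \<in> carrier S; y \<in> carrier S\<rbrakk> \<Longrightarrow> (x \<cdot> y) \<oslash> y = x \<star> y"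
  by (simp add: band_def rdiv_amult_swap)

lemma band_rdiv_left:
  "\<lbrakk>x \<in> carrier S; y \<in> carrier S; z \<in> carrier S\<rbrakk> \<Longrightarrow> (x \<star> y) \<oslash> z = x \<oslash> z"
  by (simp add: band_def rdiv_amult_rdiv)

lemma band_left:
  "\<lbrakk>x \<in> carrier S; y \<in> carrier S; z \<in> carrier S\<rbrakk> \<Longrightarrow> (x \<star> y) \<star> z = x \<star> z"
  by (simp add: band_def rdiv_amult_rdiv)

lemma amult_band:
  "\<lbrakk>x \<in> carrier S; y \<in> carrier S; z \<in> carrier S\<rbrakk> \<Longrightarrow> x \<cdot> (y \<star> z) = (x \<cdot> y) \<star> z"
  by (simp add: band_def amult_rdiv_amult)

lemma ldiv_band:
  assumes "x \<in> carrier S" "y \<in> carrier S" "z \<in> carrier S"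
  shows "x \<setminus> (y \<star> z) = (x \<setminus> y) \<star> z"
  using assms by (metis amult_band amult_ldiv ldiv_amult ldiv_closed band_closed)

text \<open>
  By \<open>band_left\<close> the map \<open>u \<mapsto> u \<star> z\<close> fixes every element of the form
  \<open>w \<star> z\<close>, and \<open>z\<close> itself has this form, with \<open>w = (z \<oslash> z) \<setminus> z\<close>.
\<close>

lemma band_idem:
  assumes z: "z \<in> carrier S"
  shows "z \<star> z = z"
proof -
  define w where "w = (z \<oslash> z) \<setminus> z"
  have w: "w \<in> carrier S"
    using z by (simp add: w_def closed)
  have "(z \<oslash> z) \<setminus> (z \<star> z) = z"
    using z by (simp add: band_def ldiv_amult closed)
  then have "z = w \<star> z"
    using z by (simp add: ldiv_band w_def closed)
  then show ?thesis
    using z w band_left by metis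
qed

text \<open>
  Put \<open>v = x \<oslash> (y \<star> z)\<close>. Then \<open>x \<star> (y \<star> z) = v \<cdot> (y \<star> z)\<close> lies in the
  image of right multiplication by \<open>z\<close> in the band, where that multiplication is the identity;
  on the other hand it sends \<open>x \<star> (y \<star> z)\<close> to \<open>x \<star> z\<close>.
\<close>

lemma band_right:
  assumes x: "x \<in> carrier S" and y: "y \<in> carrier S" and z: "z \<in> carrier S"
  shows "x \<star> (y \<star> z) = x \<star> z"
proof -
  define v where "v = x \<oslash> (y \<star> z)"
  have v: "v \<in> carrier S"
    using assms by (simp add: v_def closed)
  have "x \<star> (y \<star> z) = (v \<cdot> y) \<star> z"
    using assms v by (simp add: band_def[of x] v_def[symmetric] amult_band)
  then have "x \<star> (y \<star> z) = (x \<star> (y \<star> z)) \<star> z"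
    using assms v by (simp add: band_left closed)
  then show ?thesis
    using assms by (simp add: band_left closed)
qed

text \<open>
  The two products have the same right quotient by \<open>z\<close>, so they agree after
  right multiplication by \<open>z\<close> in the band; but a product with right factor \<open>z\<close> is
  unchanged by this, because \<open>z\<close> is idempotent.
\<close>

lemma amult_band_left:
  assumes x: "x \<in> carrier S" and y: "y \<in> carrier S" and z: "z \<in> carrier S"
  shows "(x \<star> y) \<cdot> z = x \<cdot> z"
proof -
  have fix_band: "(u \<cdot> z) \<star> z = u \<cdot> z" if "u \<in> carrier S" for u
    using that z amult_band[of u z z] by (simp add: band_idem)
  have "((x \<star> y) \<cdot> z) \<oslash> z = (x \<cdot> z) \<oslash> z"
    using assms by (simp add: amult_rdiv_eq_band band_left closed)
  then have "((x \<star> y) \<cdot> z) \<star> z = (x \<cdot> z) \<star> z"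
    by (simp add: band_def)
  then show ?thesis
    using assms by (simp add: fix_band closed)
qed

lemma ldiv_band_left:
  assumes "x \<in> carrier S" "y \<in> carrier S" "z \<in> carrier S"
  shows "(x \<star> y) \<setminus> z = x \<setminus> z"
  using assms by (metis amult_band_left amult_ldiv ldiv_amult ldiv_closed band_closed)

text \<open>
  Both sides are \<open>(w \<cdot> (y \<star> e)) \<oslash> (y \<star> e)\<close> for \<open>w = x \<oslash> y\<close>.
\<close>

lemma rdiv_band:
  assumes x: "x \<in> carrier S" and y: "y \<in> carrier S" and e: "e \<in> carrier S"
  shows "x \<oslash> (y \<star> e) = (x \<oslash> y) \<star> e"
proof -
  have "(x \<oslash> y) \<cdot> (y \<star> e) = x \<star> e"
    using assms band_def[of x y] by (simp add: amult_band band_left closed flip: band_def)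
  then have "(x \<star> e) \<oslash> (y \<star> e) = (x \<oslash> y) \<star> (y \<star> e)"
    using assms amult_rdiv_eq_band[of "x \<oslash> y" "y \<star> e"] by (simp add: closed)
  then show ?thesis
    using assms by (simp add: band_rdiv_left band_right closed)
qed

section \<open>The two coordinates\<close>

lemma band_amult:
  "\<lbrakk>x \<in> carrier S; y \<in> carrier S; e \<in> carrier S\<rbrakk> \<Longrightarrow> (x \<cdot> y) \<star> e = (x \<star> e) \<cdot> (y \<star> e)"
  by (simp add: amult_band_left amult_band closed)

lemma band_ldiv:
  "\<lbrakk>x \<in> carrier S; y \<in> carrier S; e \<in> carrier S\<rbrakk> \<Longrightarrow> (x \<setminus> y) \<star> e = (x \<star> e) \<setminus> (y \<star> e)"
  by (simp add: ldiv_band_left ldiv_band closed)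

lemma band_rdiv:
  "\<lbrakk>x \<in> carrier S; y \<in> carrier S; e \<in> carrier S\<rbrakk> \<Longrightarrow> (x \<oslash> y) \<star> e = (x \<star> e) \<oslash> (y \<star> e)"
  by (simp add: band_rdiv_left rdiv_band closed)

text \<open>
  Idempotence of \<open>y\<close> and the commutation laws put each of the three results in the form
  \<open>w \<star> y\<close>, and \<open>e \<star> (w \<star> y)\<close> forgets \<open>w\<close>.
\<close>

lemma band_absorb:
  assumes "e \<in> carrier S" "x \<in> carrier S" "y \<in> carrier S"
  shows "e \<star> (x \<cdot> y) = e \<star> y" "e \<star> (x \<setminus> y) = e \<star> y" "e \<star> (x \<oslash> y) = e \<star> y"
proof -
  have "x \<cdot> y = (x \<cdot> y) \<star> y" "x \<setminus> y = (x \<setminus> y) \<star> y" "x \<oslash> y = (x \<oslash> y) \<star> y"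
    using assms amult_band[of x y y] ldiv_band[of x y y] rdiv_band[of x y y]
    by (simp_all add: band_idem)
  then show "e \<star> (x \<cdot> y) = e \<star> y" "e \<star> (x \<setminus> y) = e \<star> y" "e \<star> (x \<oslash> y) = e \<star> y"
    using assms by (metis band_right closed)+
qed

definition quasigroup_part :: "'a \<Rightarrow> 'a ternary_algebra"
  where "quasigroup_part e =
    \<lparr>carrier = (\<lambda>x. x \<star> e) ` carrier S, amult = (\<cdot>), ldiv = (\<setminus>), rdiv = (\<oslash>)\<rparr>"

text \<open>
  The right projections replace the operations of \<open>S\<close>, since the set of all
  \<open>e \<star> x\<close> is not closed under the latter unless \<open>e\<close> has an idempotent
  first coordinate.
\<close>

definition right_zero_part :: "'a \<Rightarrow> 'a ternary_algebra"
  where "right_zero_part e =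
    \<lparr>carrier = (\<lambda>x. e \<star> x) ` carrier S, amult = (\<lambda>x y. y), ldiv = (\<lambda>x y. y), rdiv = (\<lambda>x y. y)\<rparr>"

lemma right_zero_semigroup_right_zero_part: "right_zero_semigroup (right_zero_part e)"
  by unfold_locales (simp_all add: right_zero_part_def)

lemma quasigroup_quasigroup_part:
  assumes e: "e \<in> carrier S"
  shows "quasigroup (quasigroup_part e)"
proof -
  have cancel: "(x \<star> e) \<star> (y \<star> e) = x \<star> e" if "x \<in> carrier S" "y \<in> carrier S" for x y
    using that e by (simp add: band_left band_right closed)
  show ?thesis
  proof unfold_locales
    fix x y
    assume "x \<in> carrier (quasigroup_part e)" "y \<in> carrier (quasigroup_part e)"
    then obtain a b where xy: "x = a \<star> e" "y = b \<star> e" and ab: "a \<in> carrier S" "b \<in> carrier S"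
      by (auto simp: quasigroup_part_def)
    then have S: "x \<in> carrier S" "y \<in> carrier S"
      using e by (simp_all add: closed)
    show "x \<cdot>\<^bsub>quasigroup_part e\<^esub> y \<in> carrier (quasigroup_part e)"
      "x \<setminus>\<^bsub>quasigroup_part e\<^esub> y \<in> carrier (quasigroup_part e)"
      "x \<oslash>\<^bsub>quasigroup_part e\<^esub> y \<in> carrier (quasigroup_part e)"
      using ab e
      by (simp_all add: quasigroup_part_def xy closed flip: band_amult band_ldiv band_rdiv)
    show "x \<setminus>\<^bsub>quasigroup_part e\<^esub> (x \<cdot>\<^bsub>quasigroup_part e\<^esub> y) = y"
      "x \<cdot>\<^bsub>quasigroup_part e\<^esub> (x \<setminus>\<^bsub>quasigroup_part e\<^esub> y) = y"
      using S by (simp_all add: quasigroup_part_def ldiv_amult amult_ldiv)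
    have "x \<star> y = x"
      using ab by (simp add: xy cancel)
    then show "(x \<cdot>\<^bsub>quasigroup_part e\<^esub> y) \<oslash>\<^bsub>quasigroup_part e\<^esub> y = x"
      "(x \<oslash>\<^bsub>quasigroup_part e\<^esub> y) \<cdot>\<^bsub>quasigroup_part e\<^esub> y = x"
      using S by (simp_all add: quasigroup_part_def amult_rdiv_eq_band flip: band_def)
  qed
qed

lemma alg_iso_coordinates:
  assumes e: "e \<in> carrier S"
  shows "(\<lambda>x. (x \<star> e, e \<star> x)) \<in> alg_iso S (direct_prod (quasigroup_part e) (right_zero_part e))"
proof -
  have "bij_betw (\<lambda>x. (x \<star> e, e \<star> x)) (carrier S)
      (carrier (direct_prod (quasigroup_part e) (right_zero_part e)))"
    by (rule bij_betw_byWitness[where f' = "\<lambda>(a, b). a \<star> b"])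
      (use e in \<open>auto simp: direct_prod_def quasigroup_part_def right_zero_part_def
        band_left band_right band_idem closed\<close>)
  moreover have "(x \<cdot> y) \<star> e = (x \<star> e) \<cdot>\<^bsub>quasigroup_part e\<^esub> (y \<star> e)"
    "(x \<setminus> y) \<star> e = (x \<star> e) \<setminus>\<^bsub>quasigroup_part e\<^esub> (y \<star> e)"
    "(x \<oslash> y) \<star> e = (x \<star> e) \<oslash>\<^bsub>quasigroup_part e\<^esub> (y \<star> e)"
    if "x \<in> carrier S" "y \<in> carrier S" for x y
    using that e by (simp_all add: quasigroup_part_def band_amult band_ldiv band_rdiv)
  moreover have "e \<star> (x \<cdot> y) = (e \<star> x) \<cdot>\<^bsub>right_zero_part e\<^esub> (e \<star> y)"
    "e \<star> (x \<setminus> y) = (e \<star> x) \<setminus>\<^bsub>right_zero_part e\<^esub> (e \<star> y)"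
    "e \<star> (x \<oslash> y) = (e \<star> x) \<oslash>\<^bsub>right_zero_part e\<^esub> (e \<star> y)"
    if "x \<in> carrier S" "y \<in> carrier S" for x y
    using that e by (simp_all add: right_zero_part_def band_absorb)
  ultimately show ?thesis
    by (simp add: alg_iso_def direct_prod_simps)
qed

end

section \<open>The characterization\<close>

text \<open>
  The coordinates need a base point \<open>e\<close>; an empty algebra is the product of itself with
  itself instead.
\<close>

lemma right_product_quasigroup_if_identities:
  fixes S :: "'a ternary_algebra"
  assumes "right_product_identities S"
  shows "right_product_quasigroup S"
proof (cases "carrier S = {}")
  case True
  then have "quasigroup S" "right_zero_semigroup S" "(\<lambda>x. (x, x)) \<in> alg_iso S (direct_prod S S)"
    by (auto simp: quasigroup_def quasigroup_axioms_def right_zero_semigroup_def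
        right_zero_semigroup_axioms_def div_algebra_def alg_iso_def direct_prod_def bij_betw_def)
  then show ?thesis by (rule right_product_quasigroupI)
next
  case False
  then obtain e where e: "e \<in> carrier S" by blast
  interpret right_product_identities S by fact
  show ?thesis
    by (rule right_product_quasigroupI[OF quasigroup_quasigroup_part[OF e]
          right_zero_semigroup_right_zero_part alg_iso_coordinates[OF e]])
qed

lemma right_product_quasigroup_iff_identities:
  fixes S :: "'a ternary_algebra"
  assumes "div_algebra S"
  shows "right_product_quasigroup S \<longleftrightarrow> right_product_identities S"
proof
  assume "right_product_quasigroup S"
  then obtain Q R :: "'a ternary_algebra" and f
    where "quasigroup Q" "right_zero_semigroup R" "f \<in> alg_iso S (direct_prod Q R)"
    unfolding right_product_quasigroup_def by blast
  then show "right_product_identities S"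
    using assms right_product_identities_alg_iso right_product_identities_direct_prod by blast
qed (rule right_product_quasigroup_if_identities)

theorem theorem2p8:
  fixes S :: "'a ternary_algebra" (structure)
  assumes "div_algebra S"
  shows "right_product_quasigroup S \<longleftrightarrow>
    (\<forall>x \<in> carrier S. \<forall>y \<in> carrier S. x \<setminus> (x \<cdot> y) = y) \<and>
    (\<forall>x \<in> carrier S. \<forall>y \<in> carrier S. x \<cdot> (x \<setminus> y) = y) \<and>
    (\<forall>x \<in> carrier S. \<forall>y \<in> carrier S. (x \<oslash> y) \<cdot> y = (x \<cdot> y) \<oslash> y) \<and>
    (\<forall>x \<in> carrier S. \<forall>y \<in> carrier S. \<forall>z \<in> carrier S. ((x \<oslash> y) \<cdot> y) \<oslash> z = x \<oslash> z) \<and>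
    (\<forall>x \<in> carrier S. \<forall>y \<in> carrier S. \<forall>z \<in> carrier S.
      ((x \<cdot> y) \<oslash> z) \<cdot> z = x \<cdot> ((y \<oslash> z) \<cdot> z))"
  unfolding right_product_quasigroup_iff_identities[OF assms] right_product_identities_def
    right_product_identities_axioms_def
  using assms by blast

end
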